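(* Let $q\ge 0$ and $m\ge 1$ be integers, $\Gamma=\{-q,\dots,0,\dots,q\}$ and $N=2q+1$. Let $A\in\mathbb{C}^{m\times N}$ have entries $$A_{l,k}=e^{2\pi \mathrm{i}kt_l},\qquad t_l=\frac{l-1}{m},\quad l=1,\dots,m,\quad k\in\Gamma,$$ and let $r=\operatorname{rank}(A)=\min\{m,N\}$. Then the largest and smallest nonzero singular values of $AA^*$ are $$\sigma_1(AA^* )=\begin{cases} m, & m\ge N,\\ m\lceil N/m\rceil, & m<N,\end{cases}\qquad \sigma_r(AA^* )=\begin{cases} m, & m\ge N,\\ m\lfloor N/m\rfloor, & m<N.\end{cases}$$ Moreover, when $m\ge N$ each nonzero singular value of $AA^*$ equals $m$; and when $m<N$, writing $N=am+b$ with $a=\lfloor N/m\rfloor$ and $0\le b<m$, exactly $b$ of the $m$ singular values of $AA^*$ (counted with multiplicity) equal $m(a+1)$ and the remaining $m-b$ equal $ma$.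
   Context: $A^*$ denotes the conjugate transpose. The nonzero singular values of $AA^*$, counted with multiplicity, are listed in decreasing order $\sigma_1(AA^* )\ge\dots\ge\sigma_r(AA^* )>0$. *)

theory Defs
  imports
    "HOL-Analysis.Analysis"
    "Jordan_Normal_Form.Char_Poly"
    "Jordan_Normal_Form.Schur_Decomposition"
    "Jordan_Normal_Form.DL_Rank"
begin

text \<open>
  The singular values of M are the square roots of the eigenvalues of M* M, taken with
  multiplicity.  These eigenvalues are non-negative reals, so the real part below loses nothing.
  For M with n columns this multiset has n elements; when M has fewer rows than
  columns, it contains additional zeros compared with the convention that lists only
  min(m, n) values.  For square M the two conventions coincide.
\<close>

definition singular_values :: "complex mat \<Rightarrow> real multiset" where
  "singular_values M =
     image_mset (\<lambda>z. sqrt (Re z)) (proots (char_poly (mat_adjoint M * M)))"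

definition nonzero_singular_values :: "complex mat \<Rightarrow> real list" where
  "nonzero_singular_values M =
     rev (sorted_list_of_multiset (filter_mset (\<lambda>s. s \<noteq> 0) (singular_values M)))"

text \<open>The index starts at 1, and is meaningful up to the number of nonzero singular values.\<close>

definition singular_value :: "nat \<Rightarrow> complex mat \<Rightarrow> real" where
  "singular_value i M = nonzero_singular_values M ! (i - 1)"

end

theory Submission
  imports Defs "Jordan_Normal_Form.DL_Rank_Submatrix"
begin

text \<open>
  The rows of \<open>A\<close> are geometric progressions whose ratios are the \<open>m\<close>-th roots of unity,
  so column \<open>c\<close> depends only on \<open>c mod m\<close>. Hence \<open>A A\<^sup>* = G D G\<^sup>*\<close>, where \<open>G\<close> consists of \<open>m\<close> consecutive columns and
  \<open>D\<close> is the diagonal matrix counting how often each residue class occurs among the \<open>N\<close> columns: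
  with \<open>N = a m + b\<close> it has \<open>b\<close> entries \<open>a + 1\<close> and \<open>m - b\<close> entries \<open>a\<close>. As \<open>G G\<^sup>* = m I\<close>,
  the singular values of \<open>A A\<^sup>*\<close> are \<open>m\<close> times the entries of \<open>D\<close>. The rank of \<open>A\<close>
  comes from a nonvanishing Vandermonde minor.
\<close>

section \<open>Adjoints and spectra of conjugated diagonal matrices\<close>

lemma mat_adjoint_dim [simp]:
  "dim_row (mat_adjoint A) = dim_col A" "dim_col (mat_adjoint A) = dim_row A"
  unfolding mat_adjoint_def by auto

lemma mat_adjoint_carrier [simp]: "A \<in> carrier_mat n k \<Longrightarrow> mat_adjoint A \<in> carrier_mat k n"
  by (intro carrier_matI) auto

lemma mat_adjoint_index:
  "i < dim_col A \<Longrightarrow> j < dim_row A \<Longrightarrow> mat_adjoint A $$ (i, j) = conjugate (A $$ (j, i))"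
  unfolding mat_adjoint_def by (simp add: mat_of_rows_index)

lemma mat_adjoint_mult:
  fixes A B :: "complex mat"
  assumes "A \<in> carrier_mat n k" "B \<in> carrier_mat k l"
  shows "mat_adjoint (A * B) = mat_adjoint B * mat_adjoint A"
  using assms
  by (intro eq_matI) (auto simp: mat_adjoint_index scalar_prod_def mult.commute)

lemma mat_adjoint_adjoint: "mat_adjoint (mat_adjoint A) = A"
  by (intro eq_matI) (auto simp: mat_adjoint_index)

lemma mat_adjoint_diag_real:
  "mat_adjoint (mat_diag n (\<lambda>i. complex_of_real (d i))) = mat_diag n (\<lambda>i. complex_of_real (d i))"
  by (intro eq_matI) (auto simp: mat_adjoint_index mat_diag_def)

lemma proots_char_poly_mat_diag:
  fixes d :: "nat \<Rightarrow> 'a :: field"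
  shows "proots (char_poly (mat_diag n d)) = image_mset d (mset_set {..<n})"
proof -
  have "char_poly (mat_diag n d) = (\<Prod>a\<leftarrow>diag_mat (mat_diag n d). [:- a, 1:])"
    by (rule char_poly_upper_triangular[of _ n]) (auto simp: mat_diag_def upper_triangular_def)
  also have "diag_mat (mat_diag n d) = map d [0..<n]"
    by (auto simp: diag_mat_def mat_diag_def)
  finally have "char_poly (mat_diag n d) = (\<Prod>i\<in>{..<n}. [:- d i, 1:])"
    by (simp add: o_def prod.list_conv_set_nth atLeast0LessThan)
  then have "proots (char_poly (mat_diag n d)) = (\<Sum>i\<in>{..<n}. {#d i#})"
    by (simp add: proots_prod)
  then show ?thesis
    by (simp add: sum_unfold_sum_mset)
qed

text \<open>Up to the factor \<open>c\<close>, \<open>mat_adjoint G\<close> inverts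
  \<open>G\<close>. The product is self-adjoint, so multiplying it by its adjoint just squares it;
  the square is similar to the diagonal matrix with entries \<open>(c * d i)\<^sup>2\<close>, whose
  roots are taken without sign trouble since \<open>c * d i\<close> is nonnegative.\<close>

lemma singular_values_scaled_unitary_diag:
  fixes G :: "complex mat" and c :: real and d :: "nat \<Rightarrow> real"
  assumes G: "G \<in> carrier_mat n n"
    and GG: "G * mat_adjoint G = complex_of_real c \<cdot>\<^sub>m 1\<^sub>m n"
    and c: "c > 0" and d: "\<And>i. i < n \<Longrightarrow> d i \<ge> 0"
  shows "singular_values (G * mat_diag n (\<lambda>i. complex_of_real (d i)) * mat_adjoint G)
       = image_mset (\<lambda>i. c * d i) (mset_set {..<n})"
proof -
  define H where "H = mat_adjoint G"
  define D where "D = mat_diag n (\<lambda>i. complex_of_real (d i))"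
  define E where "E = mat_diag n (\<lambda>i. complex_of_real ((c * d i)\<^sup>2))"
  define Q where "Q = complex_of_real (1 / c) \<cdot>\<^sub>m H"
  have carr: "H \<in> carrier_mat n n" "D \<in> carrier_mat n n" "E \<in> carrier_mat n n" "Q \<in> carrier_mat n n"
    using G by (auto simp: H_def D_def E_def Q_def mat_diag_def)
  note carr = carr G
  note [simp] = assoc_mult_mat[of _ n n _ n _ n]
  have smult_smult: "x \<cdot>\<^sub>m (y \<cdot>\<^sub>m X) = (x * y) \<cdot>\<^sub>m X" for x y and X :: "complex mat"
    by (intro eq_matI) auto
  have PQ: "G * Q = 1\<^sub>m n"
    using GG c carr unfolding Q_def H_def[symmetric]
    by (auto simp: mult_smult_distrib intro!: eq_matI)
  \<comment> \<open>A right inverse of a square matrix is also a left inverse. This turns the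
    hypothesis on \<open>G * mat_adjoint G\<close> into the value of
    \<open>mat_adjoint G * G\<close>, which is what the square needs.\<close>
  have QP: "Q * G = 1\<^sub>m n"
    by (rule mat_mult_left_right_inverse[OF G carr(4) PQ])
  have H: "H = complex_of_real c \<cdot>\<^sub>m Q"
    using c by (auto simp: Q_def intro!: eq_matI)
  have HG: "H * G = complex_of_real c \<cdot>\<^sub>m 1\<^sub>m n"
    using QP carr unfolding H by (simp add: mult_smult_assoc_mat[of _ n n _ n])
  have adj: "mat_adjoint (G * D * H) = G * D * H"
    using carr mat_adjoint_mult[of "G * D" n n H n] mat_adjoint_mult[of G n n D n]
    by (simp add: H_def mat_adjoint_adjoint D_def mat_adjoint_diag_real)
  have "D * D = mat_diag n (\<lambda>i. complex_of_real ((d i)\<^sup>2))"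
    by (auto simp: D_def mat_diag_diag power2_eq_square)
  then have E: "complex_of_real (c\<^sup>2) \<cdot>\<^sub>m (D * D) = E"
    by (auto simp: E_def mat_diag_def power_mult_distrib intro!: eq_matI)
  have "mat_adjoint (G * D * H) * (G * D * H) = (G * D) * (H * G) * (D * H)"
    unfolding adj using carr by simp
  also have "\<dots> = complex_of_real c \<cdot>\<^sub>m (G * (D * D) * H)"
    unfolding HG using carr by (simp add: mult_smult_distrib[of _ n n _ n] mult_smult_assoc_mat[of _ n n _ n])
  \<comment> \<open>Writing \<open>H\<close> as \<open>c\<close> times \<open>Q\<close> yields a
    second factor \<open>c\<close>, and \<open>E\<close> absorbs both.\<close>
  also have "\<dots> = G * E * Q"
    unfolding E[symmetric] H using carr
    by (simp add: mult_smult_distrib[of _ n n _ n] mult_smult_assoc_mat[of _ n n _ n] power2_eq_square smult_smult)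
  finally have "similar_mat (mat_adjoint (G * D * H) * (G * D * H)) E"
    using carr PQ QP by (intro similar_matI[of _ _ G Q n]) auto
  then have "char_poly (mat_adjoint (G * D * H) * (G * D * H)) = char_poly E"
    by (rule char_poly_similar)
  then have "singular_values (G * D * H) =
      image_mset (\<lambda>i. sqrt (Re (complex_of_real ((c * d i)\<^sup>2)))) (mset_set {..<n})"
    unfolding singular_values_def E_def by (simp add: proots_char_poly_mat_diag image_mset.compositionality o_def)
  also have "\<dots> = image_mset (\<lambda>i. c * d i) (mset_set {..<n})"
    using c d by (intro image_mset_cong) (simp add: abs_mult)
  finally show ?thesis
    by (simp add: D_def H_def)
qed

section \<open>Rank bounds, periodic sums and the Vandermonde minor\<close>

lemma (in vec_space) rank_le_nr:
  assumes "A \<in> carrier_mat n nc"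
  shows "rank A \<le> n"
proof -
  have "set (cols A) \<subseteq> carrier_vec n"
    using assms cols_dim by blast
  then show ?thesis
    unfolding rank_def
    using subspace_dim[OF span_is_subspace fin_dim fin_dim_span_cols[OF assms]] dim_is_n by simp
qed

text \<open>Terms are grouped by residue modulo \<open>m\<close>: there are \<open>a\<close> full
  periods, and the incomplete one adds an extra occurrence of each residue below \<open>b\<close>.
  The induction on \<open>a\<close> peels off one full period.\<close>

lemma sum_periodic:
  fixes f :: "nat \<Rightarrow> 'a :: comm_semiring_1"
  assumes per: "\<And>i. f (i + m) = f i" and b: "b \<le> m"
  shows "(\<Sum>i<a * m + b. f i) = (\<Sum>j<m. of_nat (if j < b then a + 1 else a) * f j)"
proof (induction a)
  case 0
  have "(\<Sum>j<m. of_nat (if j < b then 0 + 1 else 0) * f j) = (\<Sum>j\<in>{..<m} \<inter> {j. j < b}. f j)"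
    by (subst sum.inter_restrict) (auto intro: sum.cong)
  also have "{..<m} \<inter> {j. j < b} = {..<b}"
    using b by auto
  finally show ?case
    by (simp only: mult_0 add_0)
next
  case (Suc a)
  have shift: "(\<Sum>i<m + k. f i) = (\<Sum>i<m. f i) + (\<Sum>i<k. f i)" for k
    by (induction k) (simp_all add: per add.commute[of m] add.assoc)
  have "(\<Sum>i<Suc a * m + b. f i) = (\<Sum>i<m. f i) + (\<Sum>i<a * m + b. f i)"
    using shift[of "a * m + b"] by (simp add: add.assoc)
  also have "\<dots> = (\<Sum>j<m. of_nat (if j < b then Suc a + 1 else Suc a) * f j)"
    unfolding Suc.IH sum.distrib[symmetric] by (intro sum.cong) (auto simp: algebra_simps)
  finally show ?case .
qed

text \<open>The entries of a kernel vector are the coefficients of a polynomial of degree below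
  \<open>d\<close> that has \<open>d\<close> distinct roots.\<close>

lemma vandermonde_kernel_trivial:
  fixes z :: "nat \<Rightarrow> 'a :: idom"
  assumes inj: "inj_on z {..<d}" and zero: "\<And>i. i < d \<Longrightarrow> (\<Sum>j<d. v j * z i ^ j) = 0" and k: "k < d"
  shows "v k = 0"
proof -
  define p where "p = (\<Sum>j<d. monom (v j) j)"
  have coeff: "coeff p k = (if k < d then v k else 0)" for k
    unfolding p_def by (simp add: coeff_sum if_distrib cong: if_cong)
  have "p = 0"
  proof (rule ccontr)
    assume p: "p \<noteq> 0"
    then have "degree p < d"
      using coeff by (metis leading_coeff_0_iff)
    moreover have "card (z ` {..<d}) \<le> card {x. poly p x = 0}"
      using zero by (intro card_mono poly_roots_finite[OF p]) (auto simp: p_def poly_sum poly_monom)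
    moreover have "card (z ` {..<d}) = d"
      using inj by (simp add: card_image)
    ultimately show False
      using card_poly_roots_bound[OF p] by simp
  qed
  then show ?thesis
    using coeff[of k] k by simp
qed

text \<open>The leading square minor of the largest possible size is nonzero, because nonzero row
  factors do not change the kernel of a Vandermonde matrix. The numbers of rows and columns bound
  the rank from above.\<close>

lemma rank_scaled_vandermonde:
  fixes A :: "'a :: field mat"
  assumes A: "A \<in> carrier_mat n k"
    and entry: "\<And>i j. i < n \<Longrightarrow> j < k \<Longrightarrow> A $$ (i, j) = s i * z i ^ j"
    and s: "\<And>i. i < n \<Longrightarrow> s i \<noteq> 0" and inj: "inj_on z {..<n}"
  shows "vec_space.rank n A = min n k"
proof -
  define d where "d = min n k"
  define S where "S = submatrix A {..<d} {..<d}"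
  have dn: "{i. i < n \<and> i < d} = {..<d}" "{i. i < k \<and> i < d} = {..<d}"
    by (auto simp: d_def)
  have S: "S \<in> carrier_mat d d"
    using A dn by (intro carrier_matI) (auto simp: S_def dim_submatrix)
  have S_entry: "S $$ (i, j) = s i * z i ^ j" if "i < d" "j < d" for i j
  proof -
    \<comment> \<open>An entry of a submatrix is addressed by how many selected indices precede it;
      for initial segments this leaves the position unchanged.\<close>
    have "{a \<in> {..<d}. a < i} = {..<i}" "{a \<in> {..<d}. a < j} = {..<j}"
      using that by auto
    then show ?thesis
      using submatrix_index_card[of i A j "{..<d}" "{..<d}"] A that entry
      by (simp add: S_def d_def)
  qed
  have "det S \<noteq> 0"
  proof
    assume "det S = 0"
    then obtain v where v: "v \<in> carrier_vec d" "v \<noteq> 0\<^sub>v d" "S *\<^sub>v v = 0\<^sub>v d"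
      using det_0_iff_vec_prod_zero_field[OF S] by blast
    have "(\<Sum>j<d. v $ j * z i ^ j) = 0" if i: "i < d" for i
    proof -
      have "0 = (S *\<^sub>v v) $ i"
        using v i by simp
      also have "\<dots> = (\<Sum>j<d. s i * z i ^ j * v $ j)"
        using v(1) i S S_entry by (simp add: scalar_prod_def atLeast0LessThan)
      also have "\<dots> = s i * (\<Sum>j<d. v $ j * z i ^ j)"
        by (simp add: sum_distrib_left mult_ac)
      finally show ?thesis
        using s[of i] i by (simp add: d_def)
    qed
    moreover have "inj_on z {..<d}"
      using inj by (rule inj_on_subset) (auto simp: d_def)
    ultimately have "v $ j = 0" if "j < d" for j
      using vandermonde_kernel_trivial[of z d "\<lambda>j. v $ j" j] that by blast
    then have "v = 0\<^sub>v d"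
      using v(1) by (intro eq_vecI) auto
    with v(2) show False ..
  qed
  then have "d \<le> vec_space.rank n A"
    using vec_space.rank_gt_minor[OF A, of "{..<d}" "{..<d}"] by (simp add: S_def dn)
  moreover have "vec_space.rank n A \<le> n" "vec_space.rank n A \<le> k"
    using vec_space.rank_le_nr[OF A] vec_space.rank_le_nc[OF A] by auto
  ultimately show ?thesis
    by (simp add: d_def)
qed

section \<open>The Gram matrix of the Fourier samples\<close>

text \<open>
  The factor \<open>cnj (z i) ^ q\<close>, common to a whole row, encodes the shift of the frequency window
  from \<open>{0..2q}\<close> to \<open>{-q..q}\<close>.
\<close>
lemma singular_values_fourier_gram:
  fixes A :: "complex mat" and m :: nat
  defines "z \<equiv> \<lambda>i. cis (2 * pi * real i / real m)"
  assumes m: "m > 0" and b: "b < m" and A: "A \<in> carrier_mat m (a * m + b)"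
    and entry: "\<And>i j. i < m \<Longrightarrow> j < a * m + b \<Longrightarrow> A $$ (i, j) = cnj (z i) ^ q * z i ^ j"
  shows "singular_values (A * mat_adjoint A) =
    replicate_mset b (real m * (real a + 1)) + replicate_mset (m - b) (real m * real a)"
proof -
  define N where "N = a * m + b"
  define d where "d = (\<lambda>j. real (if j < b then a + 1 else a))"
  define D where "D = mat_diag m (\<lambda>i. complex_of_real (d i))"
  define g where "g = (\<lambda>i j. cnj (z i) ^ q * z i ^ j)"
  define G where "G = Matrix.mat m m (\<lambda>(i, j). g i j)"
  have G: "G \<in> carrier_mat m m" and D: "D \<in> carrier_mat m m"
    by (auto simp: G_def D_def mat_diag_def)
  have bij: "bij_betw z {..<m} {x. x ^ m = 1}"
    unfolding z_def using Complex.bij_betw_roots_unity[OF m] .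
  have zm: "z i ^ m = 1" if "i < m" for i
    using bij_betw_apply[OF bij] that by simp
  have z1: "z i * cnj (z i) = 1" for i
    by (simp add: z_def cis_mult cis_cnj)
  have ortho: "(\<Sum>j<m. g i j * cnj (g k j)) = (if i = k then of_nat m else 0)"
    if "i < m" "k < m" for i k
  proof -
    define u where "u = z i * cnj (z k)"
    \<comment> \<open>The window shift factors out and leaves a geometric sum. Its ratio
      \<open>u\<close> is an \<open>m\<close>-th root of unity, different from 1 off the diagonal,
      where the sum therefore vanishes.\<close>
    have "(\<Sum>j<m. g i j * cnj (g k j)) = (cnj (z i) * z k) ^ q * (\<Sum>j<m. u ^ j)"
      by (simp add: g_def u_def power_mult_distrib sum_distrib_left mult_ac)
    also have "\<dots> = (if i = k then of_nat m else 0)"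
    proof (cases "i = k")
      case True
      then show ?thesis
        using z1[of k] by (simp add: u_def mult.commute)
    next
      case False
      have "u \<noteq> 1"
      proof
        assume "u = 1"
        then have "z i = z k"
          using z1[of k] by (metis u_def mult.assoc mult.commute mult.left_neutral)
        with False that bij show False
          by (auto simp: bij_betw_def inj_on_def)
      qed
      moreover have "u ^ m = 1"
        using zm that by (simp add: u_def power_mult_distrib flip: complex_cnj_power)
      ultimately show ?thesis
        using False by (simp add: geometric_sum)
    qed
    finally show ?thesis .
  qed
  have GG: "G * mat_adjoint G = complex_of_real (real m) \<cdot>\<^sub>m 1\<^sub>m m"
    using G ortho
    by (intro eq_matI) (auto simp: scalar_prod_def mat_adjoint_index G_def atLeast0LessThan)
  have "A * mat_adjoint A = G * D * mat_adjoint G"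
  proof (intro eq_matI)
    fix i k assume "i < dim_row (G * D * mat_adjoint G)" "k < dim_col (G * D * mat_adjoint G)"
    then have ik: "i < m" "k < m"
      using G by auto
    have "(A * mat_adjoint A) $$ (i, k) = (\<Sum>j<N. g i j * cnj (g k j))"
      using A ik entry by (simp add: scalar_prod_def mat_adjoint_index atLeast0LessThan g_def N_def)
    \<comment> \<open>As \<open>z i ^ m = 1\<close>, the summand has period \<open>m\<close> in
      \<open>j\<close>; the multiplicities of the residues become the diagonal of
      \<open>D\<close>.\<close>
    also have "\<dots> = (\<Sum>j<m. of_nat (if j < b then a + 1 else a) * (g i j * cnj (g k j)))"
      unfolding N_def using b zm ik by (intro sum_periodic) (auto simp: g_def power_add simp flip: complex_cnj_power)
    also have "\<dots> = (\<Sum>j<m. g i j * complex_of_real (d j) * cnj (g k j))"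
      by (intro sum.cong) (auto simp: d_def)
    also have "\<dots> = (G * D * mat_adjoint G) $$ (i, k)"
      using G D ik mat_diag_mult_right[OF G]
      by (simp add: scalar_prod_def mat_adjoint_index atLeast0LessThan G_def D_def)
    finally show "(A * mat_adjoint A) $$ (i, k) = (G * D * mat_adjoint G) $$ (i, k)" .
  qed (use A G in auto)
  then have "singular_values (A * mat_adjoint A) = image_mset (\<lambda>i. real m * d i) (mset_set {..<m})"
    using singular_values_scaled_unitary_diag[OF G GG, of d] m by (simp add: D_def d_def)
  also have "{..<m} = {..<b} \<union> {b..<m}"
    using b by auto
  also have "image_mset (\<lambda>i. real m * d i) (mset_set ({..<b} \<union> {b..<m})) =
      image_mset (\<lambda>i. real m * d i) (mset_set {..<b}) + image_mset (\<lambda>i. real m * d i) (mset_set {b..<m})"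
    by (subst mset_set_Union) auto
  also have "image_mset (\<lambda>i. real m * d i) (mset_set {..<b}) =
      image_mset (\<lambda>i. real m * (real a + 1)) (mset_set {..<b})"
    by (intro image_mset_cong) (auto simp: d_def)
  also have "image_mset (\<lambda>i. real m * d i) (mset_set {b..<m}) =
      image_mset (\<lambda>i. real m * real a) (mset_set {b..<m})"
    by (intro image_mset_cong) (auto simp: d_def)
  finally show ?thesis
    by (simp add: image_mset_const_eq)
qed

text \<open>Since \<open>x > y\<close> and \<open>y \<ge> 0\<close>, the block of \<open>x\<close>
  survives the filter and comes first in decreasing order. The case \<open>y = 0\<close> serves
  matrices \<open>A\<close> with more rows than columns, where the lower block consists of
  zeros.\<close>

lemma nonzero_singular_values_two_valued:
  assumes "singular_values M = replicate_mset k x + replicate_mset l y" and "x > y" "y \<ge> 0"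
  shows "nonzero_singular_values M = replicate k x @ (if y = 0 then [] else replicate l y)"
proof -
  let ?ys = "if y = 0 then [] else replicate l y"
  have "filter_mset (\<lambda>s. s \<noteq> 0) (singular_values M) = mset (?ys @ replicate k x)"
    using assms by (intro multiset_eqI) (auto split: if_splits)
  moreover have "sorted (?ys @ replicate k x)"
    using assms by (auto simp: sorted_append)
  ultimately show ?thesis
    unfolding nonzero_singular_values_def
    by (simp add: sorted_sort_id del: mset_append)
qed

section \<open>Rank and extreme singular values of the sampled matrix\<close>

theorem theorem9:
  fixes q m N r :: nat and t :: "nat \<Rightarrow> real" and A :: "complex mat"
  assumes "m \<ge> 1"
    and "N = 2 * q + 1"
    and "\<And>l. l \<in> {1..m} \<Longrightarrow> t l = (real l - 1) / real m"
    and "A \<in> carrier_mat m N"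
    and "\<And>l k. l \<in> {1..m} \<Longrightarrow> k \<in> {- int q..int q} \<Longrightarrow>
           A $$ (l - 1, nat (k + int q)) =
             exp (2 * complex_of_real pi * \<i> * of_int k * complex_of_real (t l))"
    and "r = vec_space.rank m A"
  shows "r = min m N \<and>
    length (nonzero_singular_values (A * mat_adjoint A)) = r \<and>
    singular_value 1 (A * mat_adjoint A) =
      (if m \<ge> N then real m else real m * of_int \<lceil>real N / real m\<rceil>) \<and>
    singular_value r (A * mat_adjoint A) =
      (if m \<ge> N then real m else real m * of_int \<lfloor>real N / real m\<rfloor>) \<and>
    (m \<ge> N \<longrightarrow>
      (\<forall>s \<in># singular_values (A * mat_adjoint A). s \<noteq> 0 \<longrightarrow> s = real m)) \<and>
    (m < N \<longrightarrow>
      (\<forall>a b :: nat. int a = \<lfloor>real N / real m\<rfloor> \<and> b < m \<and> N = a * m + b \<longrightarrow>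
         size (singular_values (A * mat_adjoint A)) = m \<and>
         count (singular_values (A * mat_adjoint A)) (real m * (real a + 1)) = b \<and>
         count (singular_values (A * mat_adjoint A)) (real m * real a) = m - b))"
proof -
  have m: "m > 0"
    using assms(1) by simp
  define z where "z = (\<lambda>i. cis (2 * pi * real i / real m))"
  define B where "B = A * mat_adjoint A"
  define a b where "a = N div m" and "b = N mod m"
  have N: "N = a * m + b" and b: "b < m"
    using m by (simp_all add: a_def b_def)
  have A: "A \<in> carrier_mat m (a * m + b)"
    using assms(4) N by simp
  have entry: "A $$ (i, j) = cnj (z i) ^ q * z i ^ j" if "i < m" "j < a * m + b" for i j
  proof -
    let ?\<theta> = "2 * pi * real i / real m"
    have t: "t (i + 1) = real i / real m"
      using assms(3)[of "i + 1"] that by simp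
    \<comment> \<open>Rows are numbered from 1 in the hypothesis, and column \<open>j\<close>
      carries the frequency \<open>j - q\<close>; the part \<open>-q\<close> of the exponent becomes
      the factor \<open>cnj (z i) ^ q\<close>.\<close>
    have "A $$ (i, j) = exp (2 * complex_of_real pi * \<i> * of_int (int j - int q) * complex_of_real (t (i + 1)))"
      using assms(5)[of "i + 1" "int j - int q"] that N assms(2) by simp
    also have "\<dots> = cis (real q * - ?\<theta> + real j * ?\<theta>)"
      unfolding cis_conv_exp t by (intro arg_cong[of _ _ exp]) (use m in \<open>simp add: field_simps\<close>)
    also have "\<dots> = cnj (z i) ^ q * z i ^ j"
      by (simp only: z_def cis_cnj Complex.DeMoivre cis_mult)
    finally show ?thesis .
  qed
  have sv: "singular_values B =
      replicate_mset b (real m * (real a + 1)) + replicate_mset (m - b) (real m * real a)"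
    unfolding B_def using m b A entry unfolding z_def by (rule singular_values_fourier_gram)
  have nsv: "nonzero_singular_values B =
      replicate b (real m * (real a + 1)) @ (if a = 0 then [] else replicate (m - b) (real m * real a))"
    using nonzero_singular_values_two_valued[OF sv] m by (simp add: algebra_simps)
  have "inj_on z {..<m}"
    using Complex.bij_betw_roots_unity[OF m] by (simp add: z_def bij_betw_def)
  then have r: "r = min m N"
    unfolding assms(6) N using A entry by (intro rank_scaled_vandermonde) (auto simp: z_def)
  have floor: "\<lfloor>real N / real m\<rfloor> = int a"
    by (simp add: a_def floor_divide_of_nat_eq)
  have ceiling: "\<lceil>real N / real m\<rceil> = int (if b = 0 then a else a + 1)"
    using m b by (intro ceiling_unique) (auto simp: N field_simps)
  have N_pos: "N > 0"
    using assms(2) by simp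
  \<comment> \<open>In the tall case only the block of \<open>m * (a + 1) = m\<close> remains, in
    the square case only that of \<open>m * a = m\<close>. In the wide case the upper block may be
    empty, namely when \<open>b = 0\<close>, which is where ceiling and floor agree; the lower one
    never is, as \<open>b < m\<close>.\<close>
  consider (tall) "N < m" "a = 0" "b = N" | (square) "N = m" "a = 1" "b = 0" | (wide) "m < N" "a \<ge> 1"
    using m by (cases N m rule: linorder_cases) (auto simp: a_def b_def div_greater_zero_iff Suc_le_eq)
  note shape = this
  have "length (nonzero_singular_values B) = r"
    using shape by cases (use b in \<open>auto simp: nsv r\<close>)
  moreover have "singular_value 1 B =
      (if m \<ge> N then real m else real m * of_int \<lceil>real N / real m\<rceil>)"
    using shape by cases (use b N_pos in \<open>auto simp: singular_value_def nsv ceiling nth_append\<close>)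
  moreover have "singular_value r B =
      (if m \<ge> N then real m else real m * of_int \<lfloor>real N / real m\<rfloor>)"
    using shape by cases (use b N_pos in \<open>auto simp: singular_value_def nsv floor r nth_append\<close>)
  moreover have "\<forall>s \<in># singular_values B. s \<noteq> 0 \<longrightarrow> s = real m" if "m \<ge> N"
    using shape that by cases (auto simp: sv split: if_splits)
  moreover have "size (singular_values B) = m \<and>
      count (singular_values B) (real m * (real a' + 1)) = b' \<and>
      count (singular_values B) (real m * real a') = m - b'"
    if "int a' = \<lfloor>real N / real m\<rfloor>" "N = a' * m + b'" for a' b'
  proof -
    \<comment> \<open>The floor determines \<open>a'\<close>, and the decomposition of
      \<open>N\<close> then determines \<open>b'\<close>.\<close>
    have "a' = a" "b' = b"
      using that floor N by auto
    then show ?thesis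
      using m b by (simp add: sv)
  qed
  ultimately show ?thesis
    unfolding B_def[symmetric] using r by blast
qed

end
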